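(* For every finite, simple, connected graph $G$, $\dim(G)\le Z(G)+6\,c(G)$.
   Context: $\dim(G)$ is the metric dimension: the minimum size of a set $S\subseteq V(G)$ such that for every two distinct vertices $u,v$ there is $s\in S$ with $d(s,u)\neq d(s,v)$ ($d$ the shortest-path distance). $Z(G)$ is the zero forcing number: the minimum size of a set $Z$ of initially black vertices (all others white) such that repeatedly applying the rule "if a black vertex has exactly one white neighbor, that neighbor becomes black" eventually makes all vertices black. The cycle rank $c(G)=|E(G)|-|V(G)|+1$ is the minimum number of edges whose removal from $G$ leaves a tree. *)

theory Defs
  imports "Graph_Theory.Graph_Theory"
begin

text \<open>
  A finite simple graph is a \<^locale>\<open>pair_graph\<close>: a finite, loop-free, symmetric arc relation on
  a finite vertex set. Every undirected edge \<open>{u, v}\<close> is represented by the two arcs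
  \<open>(u, v)\<close> and \<open>(v, u)\<close>.
\<close>

definition edges :: "'a pair_pre_digraph \<Rightarrow> 'a set set" where
  "edges G = (\<lambda>(u, v). {u, v}) ` parcs G"

definition neighbors :: "'a pair_pre_digraph \<Rightarrow> 'a \<Rightarrow> 'a set" where
  "neighbors G v = {w. (v, w) \<in> parcs G}"

text \<open>Only meaningful if \<open>v\<close> is reachable from \<open>u\<close>.\<close>

definition graph_dist :: "'a pair_pre_digraph \<Rightarrow> 'a \<Rightarrow> 'a \<Rightarrow> nat" where
  "graph_dist G u v = (LEAST n. \<exists>p. pre_digraph.awalk (with_proj G) u p v \<and> length p = n)"

lemma (in wf_digraph) awalk_cost_one: "awalk_cost (\<lambda>_. 1) p = real (length p)"
  by (induction p) auto

lemma (in pair_wf_digraph) \<mu>_eq_graph_dist: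
  assumes "u \<rightarrow>\<^sup>*\<^bsub>with_proj G\<^esub> v"
  shows "\<mu> (\<lambda>_. 1) u v = ereal (real (graph_dist G u v))"
proof -
  let ?P = "\<lambda>n. \<exists>p. awalk u p v \<and> length p = n"
  from assms obtain p where "awalk u p v"
    by (auto simp: reachable_awalk)
  then have "?P (length p)" by blast
  then have "?P (Least ?P)" by (rule LeastI)
  then obtain q where q: "awalk u q v" "length q = graph_dist G u v"
    unfolding graph_dist_def by blast
  have le: "graph_dist G u v \<le> length r" if "awalk u r v" for r
    unfolding graph_dist_def using that by (intro Least_le) blast
  show ?thesis
    unfolding \<mu>_def awalk_cost_one
  proof (rule antisym)
    show "(INF p\<in>{p. awalk u p v}. ereal (real (length p))) \<le> ereal (real (graph_dist G u v))"
      using q by (intro INF_lower2[of q]) auto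
    show "ereal (real (graph_dist G u v)) \<le> (INF p\<in>{p. awalk u p v}. ereal (real (length p)))"
      using le by (intro INF_greatest) auto
  qed
qed

definition resolving_set :: "'a pair_pre_digraph \<Rightarrow> 'a set \<Rightarrow> bool" where
  "resolving_set G S \<longleftrightarrow> S \<subseteq> pverts G \<and>
     (\<forall>u\<in>pverts G. \<forall>v\<in>pverts G. u \<noteq> v \<longrightarrow> (\<exists>s\<in>S. graph_dist G s u \<noteq> graph_dist G s v))"

definition metric_dimension :: "'a pair_pre_digraph \<Rightarrow> nat" where
  "metric_dimension G = (LEAST k. \<exists>S. resolving_set G S \<and> card S = k)"

text \<open>One application of the colour change rule; \<open>B\<close> is the set of black vertices.\<close>

definition force_step :: "'a pair_pre_digraph \<Rightarrow> 'a set \<Rightarrow> 'a set \<Rightarrow> bool" where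
  "force_step G B B' \<longleftrightarrow> (\<exists>b\<in>B. \<exists>w. neighbors G b - B = {w} \<and> B' = insert w B)"

definition zero_forcing_set :: "'a pair_pre_digraph \<Rightarrow> 'a set \<Rightarrow> bool" where
  "zero_forcing_set G Z \<longleftrightarrow> Z \<subseteq> pverts G \<and> (force_step G)\<^sup>*\<^sup>* Z (pverts G)"

definition zero_forcing_number :: "'a pair_pre_digraph \<Rightarrow> nat" where
  "zero_forcing_number G = (LEAST k. \<exists>Z. zero_forcing_set G Z \<and> card Z = k)"

definition cycle_rank :: "'a pair_pre_digraph \<Rightarrow> int" where
  "cycle_rank G = int (card (edges G)) - int (card (pverts G)) + 1"

end

theory Submission
  imports Defs
begin

text \<open>
  Let \<open>Z\<close> be a minimum zero forcing set, \<open>r \<in> Z\<close>, and fix a breadth-first search tree rooted at \<open>r\<close>.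
  The set \<open>Z\<close> together with the at most \<open>2 c(G)\<close> endpoints of non-tree edges is resolving; call
  these endpoints and \<open>r\<close> terminals.

  Suppose \<open>u \<noteq> v\<close> are not resolved. They have the same depth, since \<open>r \<in> Z\<close>. Let \<open>x\<close> be the deepest
  ancestor of \<open>u\<close> that lies above some terminal, let \<open>s\<close> be a terminal of minimal depth below \<open>x\<close>, and
  define \<open>y\<close> and \<open>t\<close> likewise for \<open>v\<close>. A shortest path from \<open>v\<close> to \<open>s\<close> follows the tree up to its first
  terminal. Since vertical tree paths are geodesics, comparing the distances of \<open>u\<close> and \<open>v\<close> to \<open>s\<close>
  and to \<open>t\<close> forces \<open>x = y\<close>. Then the branches at the lowest common ancestor of \<open>u\<close> and \<open>v\<close> that contain
  \<open>u\<close> and \<open>v\<close> are free of terminals, so the rest of the graph reaches them only through this ancestor,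
  which has two neighbours in their union. Hence no zero forcing set avoids both branches, and an element
  of \<open>Z\<close> in one of them is closer to that one of \<open>u\<close>, \<open>v\<close> which lies in the same branch.
\<close>

section \<open>Distances and forts in connected graphs\<close>

locale connected_pair_graph = pair_graph G for G :: "'a pair_pre_digraph" +
  assumes connected: "Digraph_Component.connected (with_proj G)"
begin

abbreviation V :: "'a set" where "V \<equiv> pverts G"
abbreviation d :: "'a \<Rightarrow> 'a \<Rightarrow> nat" where "d \<equiv> graph_dist G"

lemma arc_sym: "(p, q) \<in> parcs G \<Longrightarrow> (q, p) \<in> parcs G"
  using pair_sym_arcs by (auto simp: symmetric_def sym_def)

lemma verts_nonempty: "V \<noteq> {}"
  using connected by (auto simp: connected_def strongly_connected_def)

lemma ex_awalk:
  assumes "u \<in> V" "v \<in> V"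
  shows "\<exists>p. awalk u p v"
proof -
  have "strongly_connected (with_proj G)"
    using connected sym_arcs by (intro symmetric_connected_imp_strongly_connected) auto
  then show ?thesis
    using assms by (auto simp: strongly_connected_def reachable_awalk)
qed

lemma shortest_awalk:
  assumes "u \<in> V" "v \<in> V"
  obtains p where "awalk u p v" "length p = d u v"
proof -
  have "\<exists>n p. awalk u p v \<and> length p = n"
    using ex_awalk[OF assms] by blast
  from LeastI_ex[OF this] show ?thesis
    using that unfolding graph_dist_def by blast
qed

lemma dist_le_length: "awalk u p v \<Longrightarrow> d u v \<le> length p"
  unfolding graph_dist_def by (intro Least_le) blast

lemma dist_self [simp]: "u \<in> V \<Longrightarrow> d u u = 0"
  using dist_le_length[of u "[]" u] by (simp add: awalk_Nil_iff)

lemma dist_eq_0: "u \<in> V \<Longrightarrow> v \<in> V \<Longrightarrow> d u v = 0 \<longleftrightarrow> u = v"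
  by (metis shortest_awalk dist_self length_0_conv awalk_Nil_iff)

lemma dist_arc_right:
  assumes "u \<in> V" "(p, q) \<in> parcs G"
  shows "d u q \<le> d u p + 1"
proof -
  obtain w where w: "awalk u w p" "length w = d u p"
    using assms shortest_awalk in_arcsD1 by blast
  have "awalk p [(p, q)] q"
    using assms arc_implies_awalk[of "(p, q)"] by simp
  with w(1) have "awalk u (w @ [(p, q)]) q"
    by (rule awalk_appendI)
  from dist_le_length[OF this] w(2) show ?thesis by simp
qed

lemma dist_SucE:
  assumes "u \<in> V" "v \<in> V" "d u v = Suc n"
  obtains w where "(u, w) \<in> parcs G" "d w v = n"
proof -
  obtain p where p: "awalk u p v" "length p = Suc n"
    using assms shortest_awalk by metis
  then obtain e es where es: "p = e # es" by (cases p) auto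
  then have e: "e \<in> parcs G" "fst e = u" "awalk (snd e) es v"
    using p by (auto simp: awalk_Cons_iff)
  have arc: "(u, snd e) \<in> parcs G" using e by (metis prod.collapse)
  have "d (snd e) v \<le> n" using dist_le_length[OF e(3)] p es by simp
  moreover have "Suc n \<le> d (snd e) v + 1"
  proof -
    obtain q where q: "awalk (snd e) q v" "length q = d (snd e) v"
      using assms shortest_awalk arc in_arcsD2 by blast
    have "awalk u (e # q) v" using q e assms by (auto simp: awalk_Cons_iff)
    from dist_le_length[OF this] show ?thesis using q assms by simp
  qed
  ultimately show ?thesis using that arc by force
qed

text \<open>Induction along a shortest path from \<open>u\<close> to \<open>v\<close>. Values in
  \<open>int\<close> allow a signed \<open>f\<close>, so that a suitable \<open>f\<close> yields
  lower bounds on distances across a cut.\<close>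

lemma lipschitz_le_dist:
  fixes f :: "'a \<Rightarrow> int"
  assumes "\<And>p q. (p, q) \<in> parcs G \<Longrightarrow> f p \<le> f q + 1" "u \<in> V" "v \<in> V"
  shows "f u - f v \<le> int (d u v)"
  using assms(2)
proof (induction "d u v" arbitrary: u)
  case 0
  then show ?case using assms(3) dist_eq_0[of u v] by simp
next
  case (Suc n)
  then obtain w where w: "(u, w) \<in> parcs G" "d w v = n"
    using dist_SucE[of u v n] assms(3) by metis
  then have "f w - f v \<le> int n" using Suc in_arcsD2 by blast
  then show ?case using assms(1)[OF w(1)] Suc(2) by linarith
qed

lemma dist_commute:
  assumes "u \<in> V" "v \<in> V"
  shows "d u v = d v u"
proof -
  have "d y x \<le> d x y" if "x \<in> V" "y \<in> V" for x y
    using lipschitz_le_dist[of "\<lambda>w. int (d y w)" x y] that dist_arc_right[of y] arc_sym by force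
  then show ?thesis using assms by (meson antisym)
qed

lemma dist_triangle:
  assumes "u \<in> V" "v \<in> V" "w \<in> V"
  shows "d u w \<le> d u v + d v w"
  using lipschitz_le_dist[of "\<lambda>x. int (d u x)" w v] assms dist_arc_right[of u] arc_sym
    dist_commute[of v w] by force

text \<open>\<open>F\<close> is a fort: no vertex outside sees exactly one vertex of it. As long as
  \<open>F\<close> is entirely white, the first of its vertices to turn black would be forced from
  outside by a vertex with no other neighbour in \<open>F\<close>.\<close>

lemma zero_forcing_set_meets_fort:
  assumes "zero_forcing_set G Z" "F \<subseteq> V" "F \<noteq> {}"
    and fort: "\<And>p w. p \<notin> F \<Longrightarrow> neighbors G p \<inter> F \<noteq> {w}"
  shows "Z \<inter> F \<noteq> {}"
proof
  assume disj: "Z \<inter> F = {}"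
  have "B \<inter> F = {}" if "(force_step G)\<^sup>*\<^sup>* Z B" for B
    using that
  proof induction
    case base
    show ?case by (rule disj)
  next
    case (step B C)
    then obtain p w where p: "p \<in> B" "neighbors G p - B = {w}" "C = insert w B"
      by (auto simp: force_step_def)
    have "w \<notin> F"
    proof
      assume "w \<in> F"
      then have "neighbors G p \<inter> F = {w}" using p step.IH by blast
      then show False using fort[of p w] p step.IH by blast
    qed
    then show ?case using p step.IH by blast
  qed
  then show False using assms unfolding zero_forcing_set_def by blast
qed

text \<open>The whole vertex set is a fort, since a point outside it has no neighbours.\<close>

lemma zero_forcing_set_nonempty:
  assumes "zero_forcing_set G Z"
  shows "Z \<noteq> {}"
  using zero_forcing_set_meets_fort[OF assms, of V] verts_nonempty in_arcsD1
  by (fastforce simp: neighbors_def)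

end

section \<open>Breadth-first search trees\<close>

locale bfs_tree = connected_pair_graph G for G :: "'a pair_pre_digraph" +
  fixes r :: 'a and par :: "'a \<Rightarrow> 'a"
  assumes root: "r \<in> pverts G"
    and par_arc: "v \<in> pverts G \<Longrightarrow> v \<noteq> r \<Longrightarrow> (v, par v) \<in> parcs G"
    and par_dist: "v \<in> pverts G \<Longrightarrow> v \<noteq> r \<Longrightarrow> graph_dist G r v = Suc (graph_dist G r (par v))"

lemma (in connected_pair_graph) bfs_tree_exists:
  assumes "r \<in> V"
  shows "\<exists>par. bfs_tree G r par"
proof -
  have "\<exists>w. (v, w) \<in> parcs G \<and> d r v = Suc (d r w)" if v: "v \<in> V" "v \<noteq> r" for v
  proof -
    obtain n where n: "d v r = Suc n"
      using dist_eq_0[of v r] v assms not0_implies_Suc by auto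
    then obtain w where "(v, w) \<in> parcs G" "d w r = n"
      using dist_SucE[of v r n] v assms by metis
    then show ?thesis using n v assms dist_commute in_arcsD2 by metis
  qed
  then obtain par where "\<forall>v. v \<in> V \<and> v \<noteq> r \<longrightarrow> (v, par v) \<in> parcs G \<and> d r v = Suc (d r (par v))"
    by metis
  then have "bfs_tree G r par" using assms by unfold_locales auto
  then show ?thesis by blast
qed

context bfs_tree
begin

abbreviation D :: "'a \<Rightarrow> nat" where "D v \<equiv> d r v"

text \<open>The guards are there because \<open>par\<close> is arbitrary at \<open>r\<close> and
  outside \<open>V\<close>.\<close>

definition child_of :: "'a \<Rightarrow> 'a \<Rightarrow> bool" where
  "child_of v w \<longleftrightarrow> v \<in> V \<and> v \<noteq> r \<and> w = par v"

abbreviation below :: "'a \<Rightarrow> 'a \<Rightarrow> bool" where "below \<equiv> child_of\<^sup>*\<^sup>*"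

definition cotree_arcs :: "('a \<times> 'a) set" where
  "cotree_arcs = {(p, q) \<in> parcs G. \<not> child_of p q \<and> \<not> child_of q p}"

text \<open>\<open>cotree_arcs\<close> is closed under reversal, so \<open>fst\<close> collects both
  ends of every non-tree edge. Including \<open>r\<close> ensures that every vertex has an ancestor
  above a terminal.\<close>

definition terminals :: "'a set" where
  "terminals = insert r (fst ` cotree_arcs)"

lemma child_ofD:
  assumes "child_of v w"
  shows "v \<in> V" "w \<in> V" "(v, w) \<in> parcs G" "D v = Suc (D w)"
  using assms par_arc par_dist in_arcsD2 unfolding child_of_def by blast+

lemma arc_cases:
  assumes "(p, q) \<in> parcs G"
  obtains "child_of p q" | "child_of q p" | "p \<in> terminals" "q \<in> terminals"
proof -
  have "(p, q) \<in> cotree_arcs \<and> (q, p) \<in> cotree_arcs \<or> child_of p q \<or> child_of q p"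
    using assms arc_sym by (auto simp: cotree_arcs_def)
  then show ?thesis using that unfolding terminals_def by force
qed

lemma terminals_subset: "terminals \<subseteq> V"
  using root in_arcsD1 by (auto simp: terminals_def cotree_arcs_def)

lemma below_in_verts: "below u w \<Longrightarrow> u \<in> V \<Longrightarrow> w \<in> V"
  by (induction rule: rtranclp_induct) (auto dest: child_ofD)

lemma below_in_verts': "below u w \<Longrightarrow> w \<in> V \<Longrightarrow> u \<in> V"
  by (induction rule: converse_rtranclp_induct) (auto dest: child_ofD)

lemma below_depth: "below u w \<Longrightarrow> D w \<le> D u"
  by (induction rule: rtranclp_induct) (auto dest: child_ofD)

lemma below_dist:
  assumes "below u w" "u \<in> V"
  shows "d u w + D w \<le> D u"
  using assms(1)
proof (induction rule: rtranclp_induct)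
  case base
  then show ?case using assms by simp
next
  case (step x y)
  have "d u y \<le> d u x + 1" using step assms dist_arc_right child_ofD(3) by blast
  then show ?case using step child_ofD(4)[of x y] by simp
qed

lemma below_root: "u \<in> V \<Longrightarrow> below u r"
proof (induction "D u" arbitrary: u)
  case 0
  then show ?case using dist_eq_0 root by fastforce
next
  case (Suc n)
  then have "child_of u (par u)" using root by (auto simp: child_of_def)
  then show ?case
    using Suc child_ofD[of u "par u"] by (metis converse_rtranclp_into_rtranclp old.nat.inject)
qed

lemma below_parent:
  assumes "below u w" "u \<noteq> w" "child_of u v"
  shows "below v w"
  using assms(1)
proof (cases rule: converse_rtranclpE)
  case base
  then show ?thesis using assms(2) by simp
next
  case (step x)
  then show ?thesis using assms(3) by (simp add: child_of_def)
qed

lemma below_linear: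
  assumes "below u x" "below u y" "D x \<le> D y"
  shows "below y x"
  using assms(2,1,3)
proof (induction rule: converse_rtranclp_induct)
  case base
  then show ?case by simp
next
  case (step u w)
  show ?case
  proof (cases "u = x")
    case True
    \<comment> \<open>\<open>u = x\<close> would put \<open>x\<close> strictly deeper than
      \<open>y\<close>.\<close>
    have "D y \<le> D w" using step.hyps(2) by (rule below_depth)
    then have False using True step child_ofD(4)[of u w] by simp
    then show ?thesis ..
  next
    case False
    then have "below w x" using below_parent step.prems(1) step.hyps(1) by blast
    then show ?thesis using step.IH step.prems(2) by blast
  qed
qed

lemma below_same_depth:
  assumes "below u x" "D x = D u"
  shows "u = x"
  using assms(1)
proof (cases rule: converse_rtranclpE)
  case (step w)
  then show ?thesis using child_ofD(4)[of u w] below_depth[of w x] assms by simp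
qed

lemma below_unique: "below u x \<Longrightarrow> below u y \<Longrightarrow> D x = D y \<Longrightarrow> x = y"
  using below_linear[of u x y] below_same_depth by auto

lemma dist_via_common_ancestor:
  assumes "below u w" "below v w" "u \<in> V" "v \<in> V"
  shows "d u v + 2 * D w \<le> D u + D v"
proof -
  have w: "w \<in> V" using assms below_in_verts by blast
  have "d u v \<le> d u w + d w v" using assms w dist_triangle by blast
  then show ?thesis
    using below_dist[of u w] below_dist[of v w] assms dist_commute[of w v] w by simp
qed

lemma depth_diff_le_dist: "u \<in> V \<Longrightarrow> v \<in> V \<Longrightarrow> D u \<le> D v + d v u"
  using dist_triangle root by blast

section \<open>Shortest paths, terminals and terminal-free subtrees\<close>

text \<open>The vertex \<open>q\<close> is the first terminal on a shortest path from \<open>u\<close> to \<open>s\<close>; up to \<open>q\<close> this path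
  uses tree edges only.\<close>

lemma first_terminal:
  assumes "s \<in> terminals" "u \<in> V"
  shows "\<exists>q\<in>terminals. \<exists>w. below u w \<and> below q w \<and>
    d u s + 2 * D w = D u + D q + d q s"
  using assms(2)
proof (induction "d u s" arbitrary: u)
  case 0
  then have "u = s" using dist_eq_0[of u s] assms terminals_subset by auto
  then show ?case using assms by (intro bexI[of _ s] exI[of _ s]) auto
next
  case (Suc n)
  have sV: "s \<in> V" using assms terminals_subset by blast
  show ?case
  proof (cases "u \<in> terminals")
    case True
    then show ?thesis by (intro bexI[of _ u] exI[of _ u]) auto
  next
    case False
    obtain u' where u': "(u, u') \<in> parcs G" "d u' s = n"
      using dist_SucE[of u s n] Suc sV by metis
    then have u'V: "u' \<in> V" using in_arcsD2 by blast
    obtain q w where q: "q \<in> terminals" "below u' w" "below q w"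
      "n + 2 * D w = D u' + D q + d q s"
      using Suc(1)[of u'] u' u'V by auto
    have qV: "q \<in> V" using q terminals_subset by blast
    from u'(1) show ?thesis
    proof (cases rule: arc_cases)
      case 1
      then have "below u w" using q(2) by (rule converse_rtranclp_into_rtranclp)
      moreover have "d u s + 2 * D w = D u + D q + d q s"
        using q 1 child_ofD(4)[OF 1] Suc(2) by simp
      ultimately show ?thesis using q by blast
    next
      case 2
      show ?thesis
      proof (cases "w = u'")
        case True
        \<comment> \<open>The path starts by going down, so its highest point moves up from
          \<open>u'\<close> to \<open>u\<close>.\<close>
        then have "below q u" using q(3) 2 rtranclp.rtrancl_into_rtrancl[of child_of q u' u] by simp
        moreover have "d u s + 2 * D u = D u + D q + d q s"
          using q True child_ofD(4)[OF 2] Suc(2) by simp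
        ultimately show ?thesis using q by blast
      next
        case False
        \<comment> \<open>The path would go down to \<open>u'\<close> and climb back through
          \<open>u\<close>, too long for a geodesic.\<close>
        then have uw: "below u w" using below_parent[of u' w u] q(2) 2 by simp
        have "d u s \<le> d u q + d q s" using dist_triangle qV sV Suc by blast
        moreover have "d u q + 2 * D w \<le> D u + D q"
          using dist_via_common_ancestor uw q qV Suc by blast
        ultimately have False using q child_ofD(4)[OF 2] Suc(2) by simp
        then show ?thesis ..
      qed
    next
      case 3
      then show ?thesis using False by blast
    qed
  qed
qed

text \<open>Non-tree edges join terminals, so only a tree edge can leave the subtree of
  \<open>a\<close>, and it does so at the top.\<close>

lemma leave_terminal_free_subtree:
  assumes free: "\<And>s. s \<in> terminals \<Longrightarrow> \<not> below s a"
    and "child_of a m" "(p, q) \<in> parcs G" "below p a" "\<not> below q a"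
  shows "p = a \<and> q = m"
  using assms(3)
proof (cases rule: arc_cases)
  case 1
  show ?thesis
  proof (cases "p = a")
    case True
    then show ?thesis using 1 assms(2) by (simp add: child_of_def)
  next
    case False
    then have "below q a" using below_parent[OF assms(4) _ 1] by simp
    then show ?thesis using assms(5) by simp
  qed
next
  case 2
  then have "below q a" using assms(4) by (rule converse_rtranclp_into_rtranclp)
  then show ?thesis using assms(5) by simp
next
  case 3
  then show ?thesis using assms by blast
qed

text \<open>Every path from \<open>z\<close> to \<open>v\<close> passes through \<open>m\<close>,
  with length at least \<open>D z - D m\<close> before it and \<open>D v - D m\<close> after
  it.\<close>

lemma dist_out_of_terminal_free_subtree:
  assumes free: "\<And>s. s \<in> terminals \<Longrightarrow> \<not> below s a"
    and "child_of a m" "below z a" "\<not> below v a" "z \<in> V" "v \<in> V"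
  shows "D z + D v \<le> d z v + 2 * D m"
proof -
  \<comment> \<open>The distance to \<open>m\<close>, signed by the side of the edge \<open>am\<close>, is 1-Lipschitz.\<close>
  define f where "f w = (if below w a then int (D w) - int (D m) else int (D m) - int (D w))" for w
  have am: "D a = Suc (D m)" using assms child_ofD by blast
  have "f p \<le> f q + 1" if pq: "(p, q) \<in> parcs G" for p q
  proof -
    have D: "D p \<le> D q + 1" "D q \<le> D p + 1"
      using dist_arc_right root pq arc_sym by blast+
    consider "below p a = below q a" | "below p a" "\<not> below q a" | "\<not> below p a" "below q a"
      by blast
    then show ?thesis
    proof cases
      case 1
      then show ?thesis using D by (auto simp: f_def)
    next
      case 2
      then show ?thesis
        using leave_terminal_free_subtree[OF free assms(2) pq] am by (auto simp: f_def)
    next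
      case 3
      then show ?thesis
        using leave_terminal_free_subtree[OF free assms(2) arc_sym[OF pq]] am by (auto simp: f_def)
    qed
  qed
  from lipschitz_le_dist[of f, OF this assms(5,6)] show ?thesis
    using assms by (simp add: f_def)
qed

section \<open>The resolving set\<close>

lemma branch_point:
  assumes "u \<in> V" "v \<in> V" "u \<noteq> v" "D u = D v" "below u x" "below v x"
  obtains m a b where "child_of a m" "child_of b m" "a \<noteq> b" "below u a" "below v b" "D x \<le> D m"
proof -
  have "\<forall>w. below u w \<and> below v w \<longrightarrow> D w < Suc (D u)"
    using below_depth by (simp add: less_Suc_eq_le)
  then obtain m where um: "below u m" "below v m"
    and max: "\<And>w. below u w \<Longrightarrow> below v w \<Longrightarrow> D w \<le> D m"
    using ex_has_greatest_nat[of "\<lambda>w. below u w \<and> below v w" x D "Suc (D u)"] assms by blast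
  \<comment> \<open>Otherwise one of \<open>u\<close>, \<open>v\<close> is an ancestor of the other
    at the same depth, so they coincide.\<close>
  have neq: "u \<noteq> m" "v \<noteq> m" using um below_same_depth assms by metis+
  obtain a where "child_of a m" "below u a"
    using um(1) neq(1) by (cases rule: rtranclp.cases) auto
  moreover obtain b where "child_of b m" "below v b"
    using um(2) neq(2) by (cases rule: rtranclp.cases) auto
  ultimately have ab: "child_of a m" "child_of b m" "below u a" "below v b" by auto
  have "a \<noteq> b" using ab max[of a] child_ofD(4)[OF ab(1)] by auto
  then show ?thesis using that ab max[OF assms(5,6)] by blast
qed

lemma terminal_ancestor:
  assumes "u \<in> V"
  obtains x s where "below u x" "below s x" "s \<in> terminals"
    "\<And>w t. below u w \<Longrightarrow> t \<in> terminals \<Longrightarrow> below t w \<Longrightarrow> D w \<le> D x"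
    "\<And>t. t \<in> terminals \<Longrightarrow> below t x \<Longrightarrow> D s \<le> D t"
proof -
  have "\<forall>w. below u w \<and> (\<exists>t\<in>terminals. below t w) \<longrightarrow> D w < Suc (D u)"
    using below_depth by (simp add: less_Suc_eq_le)
  \<comment> \<open>The root is a terminal, so a candidate for \<open>x\<close> exists.\<close>
  moreover have "below u r \<and> (\<exists>t\<in>terminals. below t r)"
    using assms below_root by (auto simp: terminals_def)
  ultimately obtain x where x: "below u x" "\<exists>t\<in>terminals. below t x"
    and max: "\<And>w t. below u w \<Longrightarrow> t \<in> terminals \<Longrightarrow> below t w \<Longrightarrow> D w \<le> D x"
    using ex_has_greatest_nat[of "\<lambda>w. below u w \<and> (\<exists>t\<in>terminals. below t w)" r D "Suc (D u)"]
    by blast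
  then obtain s where s: "s \<in> terminals" "below s x"
    and min: "\<And>t. t \<in> terminals \<Longrightarrow> below t x \<Longrightarrow> D s \<le> D t"
    using ex_has_least_nat[of "\<lambda>s. s \<in> terminals \<and> below s x" _ D] by metis
  show ?thesis
    using that[OF x(1) s(2,1) max min] .
qed

lemma resolving_set_Un_terminals:
  assumes Z: "zero_forcing_set G Z" and rZ: "r \<in> Z"
  shows "resolving_set G (Z \<union> terminals)"
  unfolding resolving_set_def
proof (intro conjI ballI impI)
  have ZV: "Z \<subseteq> V" using Z by (simp add: zero_forcing_set_def)
  then show "Z \<union> terminals \<subseteq> V" using terminals_subset by blast
  fix u v assume uV: "u \<in> V" and vV: "v \<in> V" and "u \<noteq> v"
  show "\<exists>s\<in>Z \<union> terminals. d s u \<noteq> d s v"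
  proof (rule ccontr)
    assume "\<not> ?thesis"
    then have eq: "d s u = d s v" if "s \<in> Z \<union> terminals" for s using that by blast
    have Duv: "D u = D v" using eq rZ by blast
    obtain x s where x: "below u x" "below s x" "s \<in> terminals"
      and xmax: "\<And>w t. below u w \<Longrightarrow> t \<in> terminals \<Longrightarrow> below t w \<Longrightarrow> D w \<le> D x"
      and smin: "\<And>t. t \<in> terminals \<Longrightarrow> below t x \<Longrightarrow> D s \<le> D t"
      using terminal_ancestor[OF uV] by blast
    obtain y t where y: "below v y" "below t y" "t \<in> terminals"
      and ymax: "\<And>w t. below v w \<Longrightarrow> t \<in> terminals \<Longrightarrow> below t w \<Longrightarrow> D w \<le> D y"
      and tmin: "\<And>s. s \<in> terminals \<Longrightarrow> below s y \<Longrightarrow> D t \<le> D s"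
      using terminal_ancestor[OF vV] by blast
    have sV: "s \<in> V" and tV: "t \<in> V" using x y terminals_subset by auto
    have us: "d u s = d v s" and ut: "d u t = d v t"
      using eq[of s] eq[of t] x y uV vV sV tV dist_commute by auto
    obtain q w where q: "q \<in> terminals" "below v w" "below q w"
      "d v s + 2 * D w = D v + D q + d q s"
      using first_terminal[OF x(3) vV] by blast
    obtain q' w' where q': "q' \<in> terminals" "below u w'" "below q' w'"
      "d u t + 2 * D w' = D u + D q' + d q' t"
      using first_terminal[OF y(3) uV] by blast
    have qV: "q \<in> V" "q' \<in> V" using q q' terminals_subset by auto
    have bounds: "d u s + 2 * D x \<le> D u + D s" "d v t + 2 * D y \<le> D v + D t"
      using dist_via_common_ancestor x y uV vV sV tV by blast+
    have tri: "D s \<le> D q + d q s" "D t \<le> D q' + d q' t"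
      using depth_diff_le_dist qV sV tV by blast+
    have le: "D w \<le> D y" "D w' \<le> D x" using xmax ymax q q' by blast+
    \<comment> \<open>Since \<open>D q + d q s\<close> is at least \<open>D s\<close>, equating the
      distances of \<open>u\<close> and \<open>v\<close> to \<open>s\<close> gives
      \<open>D x <= D w <= D y\<close>. Symmetrically, \<open>t\<close> gives
      \<open>D y <= D w' <= D x\<close>.\<close>
    have depths: "D w = D y" "D w' = D x" "D x = D y"
      using bounds tri le q(4) q'(4) us ut Duv by linarith+
    have "w = y" "w' = x" using depths below_unique q q' x y by blast+
    then have "D t \<le> D q" "D s \<le> D q'" using tmin smin q q' by blast+
    \<comment> \<open>The bounds now read \<open>D q + d q s <= D s\<close> and
      \<open>D q' + d q' t <= D t\<close>. Hence \<open>D s <= D q' <= D t <= D q\<close>, which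
      leaves no room for \<open>d q s\<close>.\<close>
    then have "d q s = 0"
      using bounds tri depths q(4) q'(4) us ut Duv by linarith
    then have "q = s" using dist_eq_0 qV sV by blast
    then have xy: "x = y" using below_unique[of s x y] x q \<open>w = y\<close> depths by blast
    obtain m a b where ab: "child_of a m" "child_of b m" "a \<noteq> b" "below u a" "below v b" "D x \<le> D m"
      using branch_point[OF uV vV \<open>u \<noteq> v\<close> Duv x(1)] y xy by metis
    have Dab: "D a = Suc (D m)" "D b = Suc (D m)" using ab child_ofD by auto
    \<comment> \<open>\<open>a\<close> is deeper than \<open>x\<close>, so a terminal below it
      contradicts the maximality of \<open>x\<close>.\<close>
    have freea: "\<not> below t a" if "t \<in> terminals" for t
      using xmax[of a t] ab Dab that by auto
    have freeb: "\<not> below t b" if "t \<in> terminals" for t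
      using ymax[of b t] ab Dab that xy by auto
    have disj: "\<not> (below z a \<and> below z b)" for z
      using below_unique[of z a b] ab Dab by auto
    \<comment> \<open>\<open>F\<close> is a fort: only \<open>m\<close> has edges into it from
      outside, and \<open>m\<close> is adjacent to both \<open>a\<close> and
      \<open>b\<close>.\<close>
    define F where "F = {z. below z a \<or> below z b}"
    have "Z \<inter> F \<noteq> {}"
    proof (rule zero_forcing_set_meets_fort[OF Z])
      show "F \<subseteq> V"
        using below_in_verts' ab child_ofD(1) by (auto simp: F_def)
      show "F \<noteq> {}" by (auto simp: F_def)
      fix p w assume p: "p \<notin> F"
      show "neighbors G p \<inter> F \<noteq> {w}"
      proof
        assume N: "neighbors G p \<inter> F = {w}"
        then have "(w, p) \<in> parcs G" "w \<in> F" using arc_sym by (auto simp: neighbors_def)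
        then have "p = m"
          using p leave_terminal_free_subtree[OF freea ab(1)]
            leave_terminal_free_subtree[OF freeb ab(2)] by (auto simp: F_def)
        then have "a \<in> neighbors G p" "b \<in> neighbors G p"
          using ab child_ofD(3) arc_sym by (auto simp: neighbors_def)
        then have "a = w" "b = w" using N by (auto simp: F_def)
        then show False using ab by simp
      qed
    qed
    then obtain z where z: "z \<in> Z" "z \<in> F" by blast
    then have zV: "z \<in> V" using ZV by blast
    have zuv: "d z u = d z v" using eq z by blast
    from z(2) consider "below z a" | "below z b" by (auto simp: F_def)
    then show False
    proof cases
      case 1
      \<comment> \<open>Within its own branch \<open>z\<close> reaches \<open>u\<close> by turning
        at \<open>a\<close>, one level below \<open>m\<close>, which makes \<open>u\<close> closer
        than \<open>v\<close> by at least two.\<close>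
      have "d z u + 2 * D a \<le> D z + D u"
        using dist_via_common_ancestor 1 ab zV uV by blast
      moreover have "D z + D v \<le> d z v + 2 * D m"
        using dist_out_of_terminal_free_subtree[OF freea ab(1) 1 _ zV vV] disj ab by blast
      ultimately show False using zuv Duv Dab by linarith
    next
      case 2
      have "d z v + 2 * D b \<le> D z + D v"
        using dist_via_common_ancestor 2 ab zV vV by blast
      moreover have "D z + D u \<le> d z u + 2 * D m"
        using dist_out_of_terminal_free_subtree[OF freeb ab(2) 2 _ zV uV] disj ab by blast
      ultimately show False using zuv Duv Dab by linarith
    qed
  qed
qed

section \<open>Counting terminals\<close>

lemma card_terminals: "int (card (terminals - {r})) \<le> 2 * cycle_rank G"
proof -
  let ?T = "(\<lambda>v. {v, par v}) ` (V - {r})"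
  let ?E = "edges G"
  have finE: "finite ?E" by (simp add: edges_def)
  \<comment> \<open>\<open>v\<close> is the deeper end of \<open>{v, par v}\<close>, so there are
    \<open>card V - 1\<close> tree edges, and the remaining edges number
    \<open>cycle_rank G\<close>.\<close>
  have inj: "inj_on (\<lambda>v. {v, par v}) (V - {r})"
  proof (rule inj_onI)
    fix v w assume vw: "v \<in> V - {r}" "w \<in> V - {r}" "{v, par v} = {w, par w}"
    then have "D v = Suc (D (par v))" "D w = Suc (D (par w))" using par_dist by auto
    then show "v = w" using vw(3) by (auto simp: doubleton_eq_iff)
  qed
  have T: "?T \<subseteq> ?E" using par_arc by (auto simp: edges_def)
  have cardT: "card ?T = card V - 1"
    using inj root by (simp add: card_image)
  have "card V > 0" using root by (auto simp: card_gt_0_iff)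
  then have rank: "int (card (?E - ?T)) = cycle_rank G"
    using cardT card_mono[OF finE T] card_Diff_subset[OF finite_subset[OF T finE] T]
    by (simp add: cycle_rank_def of_nat_diff)
  have "terminals - {r} \<subseteq> \<Union> (?E - ?T)"
  proof
    fix p assume "p \<in> terminals - {r}"
    then obtain q where q: "(p, q) \<in> parcs G" "\<not> child_of p q" "\<not> child_of q p"
      by (auto simp: terminals_def cotree_arcs_def)
    have "{p, q} \<notin> ?T"
    proof
      assume "{p, q} \<in> ?T"
      then obtain v where "v \<in> V - {r}" "{p, q} = {v, par v}" by blast
      then show False using q by (auto simp: child_of_def doubleton_eq_iff)
    qed
    moreover have "{p, q} \<in> ?E" using q by (force simp: edges_def)
    ultimately show "p \<in> \<Union> (?E - ?T)" by blast
  qed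
  moreover have "finite (\<Union> (?E - ?T))"
    using finE by (auto simp: edges_def)
  ultimately have "card (terminals - {r}) \<le> card (\<Union> (?E - ?T))"
    by (rule card_mono[rotated])
  also have "\<dots> \<le> (\<Sum>e\<in>?E - ?T. card e)"
    using card_Union_le_sum_card by blast
  also have "\<dots> \<le> (\<Sum>e\<in>?E - ?T. 2)"
    by (intro sum_mono) (auto simp: edges_def card_insert_if)
  finally show ?thesis using rank by simp
qed

end

theorem theorem2:
  fixes G :: "'a pair_pre_digraph"
  assumes "pair_graph G"
    and "Digraph_Component.connected (with_proj G)"
  shows "int (metric_dimension G) \<le> int (zero_forcing_number G) + 6 * cycle_rank G"
proof -
  interpret connected_pair_graph G
    using assms by (simp add: connected_pair_graph_def connected_pair_graph_axioms_def)
  have "zero_forcing_set G (pverts G)" by (simp add: zero_forcing_set_def)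
  then have "\<exists>k Z. zero_forcing_set G Z \<and> card Z = k" by blast
  from LeastI_ex[OF this] obtain Z
    where Z: "zero_forcing_set G Z" "card Z = zero_forcing_number G"
    unfolding zero_forcing_number_def by blast
  obtain r where r: "r \<in> Z" using zero_forcing_set_nonempty[OF Z(1)] by blast
  have ZV: "Z \<subseteq> pverts G" using Z(1) by (simp add: zero_forcing_set_def)
  then obtain par where "bfs_tree G r par" using bfs_tree_exists r by blast
  then interpret bfs_tree G r par .
  have "metric_dimension G \<le> card (Z \<union> terminals)"
    unfolding metric_dimension_def
    by (rule Least_le) (use resolving_set_Un_terminals[OF Z(1) r] in blast)
  \<comment> \<open>The root is already counted in \<open>Z\<close>.\<close>
  also have "Z \<union> terminals = Z \<union> (terminals - {r})" using r by blast
  also have "card \<dots> \<le> card Z + card (terminals - {r})" by (rule card_Un_le)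
  \<comment> \<open>The argument yields the constant 2. Weakening it to 6 uses that the cycle rank
    is nonnegative, which \<open>card_terminals\<close> also implies.\<close>
  finally show ?thesis using card_terminals Z(2) by simp
qed

end
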